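(* For every integer $n\ge 1$, $$\mathrm{pf}_n(123,213,312)=n(n-1)+1.$$
   Context: A Dyck path of semilength $n$ is a lattice path from $(0,0)$ to $(n,n)$ consisting of $n$ north steps $N=(0,1)$ and $n$ east steps $E=(1,0)$ that never goes below the line $y=x$. A parking function of size $n$ is a Dyck path of semilength $n$ whose $n$ north steps are labeled bijectively by $\{1,\dots,n\}$ so that whenever two north steps are consecutive in the path (one immediately following the other), the label of the later one is larger. For a parking function $p$ of size $n$, $\phi(p)$ is the permutation of $\{1,\dots,n\}$ (in one-line notation) obtained by reading the labels of the north steps in the order they occur along the path. A permutation $\pi$ of $\{1,\dots,n\}$ contains a permutation $\rho$ of $\{1,\dots,m\}$ if there are indices $1\le i_1<\cdots<i_m\le n$ such that $\pi_{i_a}\le\pi_{i_b}$ if and only if $\rho_a\le\rho_b$; otherwise $\pi$ avoids $\rho$. For permutations $\rho_1,\dots,\rho_r$, $\mathrm{pf}_n(\rho_1,\dots,\rho_r)$ denotes the number of parking functions $p$ of size $n$ such that $\phi(p)$ avoids each of $\rho_1,\dots,\rho_r$. *)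

theory Defs
  imports "HOL-Combinatorics.Multiset_Permutations"
begin

datatype step = N | E

text \<open>The path starts at the origin, so after \<open>k\<close> steps it is at
  \<open>(count_list (take k w) E, count_list (take k w) N)\<close>.\<close>

definition dyck_path :: "nat \<Rightarrow> step list \<Rightarrow> bool" where
  "dyck_path n w \<longleftrightarrow>
     count_list w N = n \<and> count_list w E = n \<and>
     (\<forall>k \<le> length w. count_list (take k w) E \<le> count_list (take k w) N)"

text \<open>A step of a path whose north steps, and only those, carry labels.\<close>

datatype labelled_step = North nat | East

fun unlabel :: "labelled_step \<Rightarrow> step" where
  "unlabel (North a) = N"
| "unlabel East = E"

fun north_labels :: "labelled_step list \<Rightarrow> nat list" where
  "north_labels [] = []"
| "north_labels (North a # p) = a # north_labels p"
| "north_labels (East # p) = north_labels p"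

text \<open>\<open>north_labels p\<close> is the permutation \<open>\<phi>(p)\<close>.
  \<open>permutations_of_set {1..n}\<close> consists of the one-line notations of
  the permutations of \<open>{1..n}\<close>; membership of \<open>\<phi>(p)\<close> says that the labelling
  of the north steps is a bijection onto \<open>{1..n}\<close>.\<close>

definition parking_function :: "nat \<Rightarrow> labelled_step list \<Rightarrow> bool" where
  "parking_function n p \<longleftrightarrow>
     dyck_path n (map unlabel p) \<and>
     north_labels p \<in> permutations_of_set {1..n} \<and>
     (\<forall>i a b. Suc i < length p \<and> p ! i = North a \<and> p ! Suc i = North b \<longrightarrow> a < b)"

definition contains_pattern :: "nat list \<Rightarrow> nat list \<Rightarrow> bool" where
  "contains_pattern \<pi> \<rho> \<longleftrightarrow>
     (\<exists>i. strict_mono_on {..<length \<rho>} i \<and>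
          (\<forall>a < length \<rho>. i a < length \<pi>) \<and>
          (\<forall>a < length \<rho>. \<forall>b < length \<rho>. \<pi> ! i a \<le> \<pi> ! i b \<longleftrightarrow> \<rho> ! a \<le> \<rho> ! b))"

definition avoids_pattern :: "nat list \<Rightarrow> nat list \<Rightarrow> bool" where
  "avoids_pattern \<pi> \<rho> \<longleftrightarrow> \<not> contains_pattern \<pi> \<rho>"

definition pf :: "nat \<Rightarrow> nat list list \<Rightarrow> nat" where
  "pf n \<rho>s = card {p. parking_function n p \<and> (\<forall>\<rho> \<in> set \<rho>s. avoids_pattern (north_labels p) \<rho>)}"

text \<open>The set counted by \<open>pf\<close> is finite, so \<open>card\<close> has its intended meaning.\<close>

lemma finite_parking_functions: "finite {p. parking_function n p}"
proof -
  have len: "length p = count_list (map unlabel p) N + count_list (map unlabel p) E" for p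
  proof (induction p)
    case (Cons s p)
    then show ?case by (cases s) auto
  qed simp
  have lab: "set p \<subseteq> insert East (North ` set (north_labels p))" for p
    by (induction p rule: north_labels.induct) auto
  have "{p. parking_function n p} \<subseteq>
      {p. set p \<subseteq> insert East (North ` {1..n}) \<and> length p = n + n}"
  proof
    fix p assume "p \<in> {p. parking_function n p}"
    then have "dyck_path n (map unlabel p)" "set (north_labels p) = {1..n}"
      by (auto simp: parking_function_def permutations_of_set_def)
    then show "p \<in> {p. set p \<subseteq> insert East (North ` {1..n}) \<and> length p = n + n}"
      using len[of p] lab[of p] by (simp add: dyck_path_def)
  qed
  then show ?thesis
    by (rule finite_subset) (simp add: finite_lists_length_eq)
qed

end

theory Submission
  imports Defs
begin

text \<open>The patterns 123, 213 and 312 are exactly those of length three that end in an ascent, so a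
  permutation \<open>a # ys\<close> avoids them iff \<open>ys\<close> is decreasing; it is thus determined by \<open>a\<close>. In a
  decreasing list of labels no two north steps may be adjacent, so after the first north step, at
  height 1, the path has to alternate between north and east steps, up to one additional east step
  that brings it down to the diagonal. If \<open>j\<close> labels precede the additional step, then
  \<open>0 \<le> j < n\<close>, and \<open>j > 0\<close> makes the path start with two north steps, which is possible iff
  \<open>a < n\<close>. This leaves the pairs \<open>(a, j)\<close> with \<open>a < n\<close> and the pair \<open>(n, 0)\<close>.\<close>

section \<open>Pattern avoidance and decreasing tails\<close>

text \<open>The last two positions of an occurrence carry the ascent, and the first one lies before
  them, so the ascent avoids position 0. This treats all three patterns at once.\<close>

lemma contains_pattern_final_ascent:
  assumes "contains_pattern \<pi> [x, y, z]" "y < z"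
  shows "\<exists>j k. 0 < j \<and> j < k \<and> k < length \<pi> \<and> \<pi> ! j < \<pi> ! k"
proof -
  obtain f where mono: "strict_mono_on {..<length [x, y, z]} f"
    and len: "\<forall>a < length [x, y, z]. f a < length \<pi>"
    and pat: "\<forall>a < length [x, y, z]. \<forall>b < length [x, y, z].
      \<pi> ! f a \<le> \<pi> ! f b \<longleftrightarrow> [x, y, z] ! a \<le> [x, y, z] ! b"
    using assms(1) unfolding contains_pattern_def by blast
  have "f 0 < f 1" "f 1 < f 2"
    by (simp_all add: strict_mono_onD[OF mono])
  moreover have "f 2 < length \<pi>"
    using len by simp
  moreover have "\<pi> ! f 1 < \<pi> ! f 2"
    using pat[rule_format, of 2 1] assms(2) by simp
  ultimately show ?thesis
    by (intro exI[of _ "f 1"] exI[of _ "f 2"]) simp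
qed

lemma contains_pattern_3I:
  assumes "i < j" "j < k" "k < length \<pi>" "length \<rho> = Suc (Suc (Suc 0))"
    and "\<forall>a < length \<rho>. \<forall>b < length \<rho>. \<pi> ! ([i, j, k] ! a) \<le> \<pi> ! ([i, j, k] ! b) \<longleftrightarrow> \<rho> ! a \<le> \<rho> ! b"
  shows "contains_pattern \<pi> \<rho>"
proof -
  have "strict_mono_on {..<length \<rho>} (\<lambda>a. [i, j, k] ! a)"
    using assms(1-4) by (auto simp: strict_mono_on_def less_Suc_eq)
  moreover have "\<forall>a < length \<rho>. [i, j, k] ! a < length \<pi>"
    using assms(1-4) by (simp add: All_less_Suc2)
  ultimately show ?thesis
    unfolding contains_pattern_def
    by (intro exI[of _ "\<lambda>a. [i, j, k] ! a"] conjI assms(5))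
qed

text \<open>An ascent in the tail forms, together with the first entry, one of the three patterns:
  123, 213 or 312 according to whether the first entry lies below, between or above the two.
  Distinctness excludes ties.\<close>

lemma avoids_123_213_312_iff:
  assumes "distinct \<pi>"
  shows "(\<forall>\<rho> \<in> set [[1, 2, 3], [2, 1, 3], [3, 1, 2]]. avoids_pattern \<pi> \<rho>) \<longleftrightarrow>
    sorted_wrt (>) (tl \<pi>)"
  (is "?L \<longleftrightarrow> ?R")
proof
  assume avoids: ?L
  show ?R
  proof (rule ccontr)
    assume "\<not> ?R"
    then obtain j k where "j < k" "k < length (tl \<pi>)" "\<not> tl \<pi> ! j > tl \<pi> ! k"
      unfolding sorted_wrt_iff_nth_less by blast
    then have jk: "0 < Suc j" "Suc j < Suc k" "Suc k < length \<pi>" "\<pi> ! Suc j \<le> \<pi> ! Suc k"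
      by (simp_all add: nth_tl)
    have ne: "\<pi> ! 0 \<noteq> \<pi> ! Suc j" "\<pi> ! 0 \<noteq> \<pi> ! Suc k" "\<pi> ! Suc j \<noteq> \<pi> ! Suc k"
      using jk(2,3) by (subst nth_eq_iff_index_eq[OF assms]; linarith)+
    then consider "\<pi> ! 0 < \<pi> ! Suc j" | "\<pi> ! Suc j < \<pi> ! 0" "\<pi> ! 0 < \<pi> ! Suc k"
      | "\<pi> ! Suc k < \<pi> ! 0"
      by linarith
    then have "contains_pattern \<pi> [1, 2, 3] \<or> contains_pattern \<pi> [2, 1, 3] \<or>
      contains_pattern \<pi> [3, 1, 2]"
    proof cases
      case 1
      then have "contains_pattern \<pi> [1, 2, 3]"
        using jk(4) ne by (intro contains_pattern_3I[OF jk(1-3)]) (simp_all add: All_less_Suc2)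
      then show ?thesis by blast
    next
      case 2
      then have "contains_pattern \<pi> [2, 1, 3]"
        using jk(4) ne by (intro contains_pattern_3I[OF jk(1-3)]) (simp_all add: All_less_Suc2)
      then show ?thesis by blast
    next
      case 3
      then have "contains_pattern \<pi> [3, 1, 2]"
        using jk(4) ne by (intro contains_pattern_3I[OF jk(1-3)]) (simp_all add: All_less_Suc2)
      then show ?thesis by blast
    qed
    then show False
      using avoids by (auto simp: avoids_pattern_def)
  qed
next
  assume dec: ?R
  \<comment> \<open>Positions in \<open>tl \<pi>\<close> are one less than in \<open>\<pi>\<close>,
    hence the bound \<open>0 < j\<close>.\<close>
  have no_ascent: "\<pi> ! k < \<pi> ! j" if "0 < j" "j < k" "k < length \<pi>" for j k
    using sorted_wrt_nth_less[OF dec, of "j - 1" "k - 1"] that by (simp add: nth_tl)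
  have "\<not> contains_pattern \<pi> [x, y, z]" if "y < z" for x y z
    using contains_pattern_final_ascent[of \<pi> x y z] that no_ascent less_asym by blast
  then show ?L
    by (simp add: avoids_pattern_def)
qed

section \<open>Parking functions described step by step\<close>

text \<open>Here \<open>h\<close> is the current height above the diagonal. Allowing any starting
  height makes the Dyck condition recursive in the remaining path.\<close>

fun dyck_from :: "nat \<Rightarrow> labelled_step list \<Rightarrow> bool" where
  "dyck_from h [] \<longleftrightarrow> h = 0"
| "dyck_from h (North a # p) \<longleftrightarrow> dyck_from (Suc h) p"
| "dyck_from 0 (East # p) \<longleftrightarrow> False"
| "dyck_from (Suc h) (East # p) \<longleftrightarrow> dyck_from h p"

lemma count_list_N: "count_list (map unlabel p) N = length (north_labels p)"
  by (induction p rule: north_labels.induct) auto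

lemma dyck_from_iff:
  "dyck_from h p \<longleftrightarrow>
     count_list (map unlabel p) E = count_list (map unlabel p) N + h \<and>
     (\<forall>k \<le> length p. count_list (take k (map unlabel p)) E \<le>
        count_list (take k (map unlabel p)) N + h)"
proof (induction h p rule: dyck_from.induct)
  case (3 p)
  have "\<exists>k \<le> length (East # p). \<not> count_list (take k (map unlabel (East # p))) E \<le>
        count_list (take k (map unlabel (East # p))) N + 0"
    by (intro exI[of _ 1]) simp
  then show ?case
    unfolding dyck_from.simps by blast
\<comment> \<open>Splitting off the prefix of length 0 leaves the condition on the remaining path at
  the new height.\<close>
qed (simp_all add: less_Suc_eq_le[symmetric] All_less_Suc2)

lemma dyck_path_iff:
  "dyck_path n (map unlabel p) \<longleftrightarrow> length (north_labels p) = n \<and> dyck_from 0 p"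
  unfolding dyck_path_def dyck_from_iff count_list_N[symmetric] by auto

definition rise :: "labelled_step \<Rightarrow> labelled_step \<Rightarrow> bool" where
  "rise s t \<longleftrightarrow> (\<forall>a b. s = North a \<and> t = North b \<longrightarrow> a < b)"

lemma rise_simps [simp]: "rise East t" "rise s East" "rise (North a) (North b) \<longleftrightarrow> a < b"
  by (auto simp: rise_def)

lemma parking_function_iff:
  "parking_function n p \<longleftrightarrow>
     dyck_from 0 p \<and> north_labels p \<in> permutations_of_set {1..n} \<and> successively rise p"
  using length_finite_permutations_of_set[of "north_labels p" "{1..n}"]
  by (auto simp: parking_function_def dyck_path_iff successively_conv_nth rise_def)

section \<open>Paths with decreasing labels\<close>

fun alternating :: "nat list \<Rightarrow> labelled_step list" where
  "alternating [] = []"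
| "alternating (y # ys) = North y # East # alternating ys"

text \<open>For \<open>j > length ys\<close> the additional east step is missing.\<close>

fun extra_east :: "nat \<Rightarrow> nat list \<Rightarrow> labelled_step list" where
  "extra_east 0 ys = East # alternating ys"
| "extra_east (Suc j) [] = []"
| "extra_east (Suc j) (y # ys) = North y # East # extra_east j ys"

lemma north_labels_alternating [simp]: "north_labels (alternating ys) = ys"
  by (induction ys) auto

lemma north_labels_extra_east [simp]:
  "j \<le> length ys \<Longrightarrow> north_labels (extra_east j ys) = ys"
  by (induction j ys rule: extra_east.induct) auto

lemma dyck_from_alternating [simp]: "dyck_from 0 (alternating ys)"
  by (induction ys) auto

lemma dyck_from_extra_east: "j \<le> length ys \<Longrightarrow> dyck_from (Suc 0) (extra_east j ys)"
  by (induction j ys rule: extra_east.induct) auto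

lemma successively_rise_East [simp]: "successively rise (East # p) \<longleftrightarrow> successively rise p"
  by (cases p) auto

lemma successively_rise_alternating [simp]: "successively rise (alternating ys)"
  by (induction ys) auto

lemma successively_rise_extra_east [simp]: "successively rise (extra_east j ys)"
  by (induction j ys rule: extra_east.induct) auto

text \<open>The first step tells \<open>j = 0\<close> (east) from \<open>j > 0\<close> (north), and
  removing a north-east pair lowers \<open>j\<close> by one. All \<open>j\<close> beyond the bound
  give the same path.\<close>

lemma inj_on_extra_east: "inj_on (\<lambda>j. extra_east j ys) {..length ys}"
proof -
  have "extra_east i ys = extra_east j ys \<Longrightarrow> i \<le> length ys \<Longrightarrow> j \<le> length ys \<Longrightarrow> i = j" for i j
  proof (induction i ys arbitrary: j rule: extra_east.induct)
    case (1 ys)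
    then show ?case by (cases j; cases ys) auto
  next
    case (3 i y ys)
    then show ?case by (cases j) auto
  qed simp
  then show ?thesis
    by (auto intro: inj_onI)
qed

text \<open>The label of the first step exceeds that of the next north step, so the second step is east.\<close>

lemma decreasing_North_cases:
  assumes "dyck_from h (North y # q)" "successively rise (North y # q)"
    and "sorted_wrt (>) (y # north_labels q)"
  obtains r where "q = East # r" "dyck_from h r" "successively rise r"
proof (cases q)
  case Nil
  then show ?thesis using assms by simp
next
  case (Cons s r)
  then show ?thesis using assms that by (cases s) auto
qed

text \<open>On the diagonal a north step is forced, and then an east step, which returns to the
  diagonal. Two steps are removed at a time, hence induction on the length.\<close>

lemma decreasing_dyck_from_0:
  assumes "dyck_from 0 p" "successively rise p" "sorted_wrt (>) (north_labels p)"
  shows "p = alternating (north_labels p)"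
  using assms
proof (induction p rule: length_induct)
  case (1 p)
  show ?case
  proof (cases p)
    case (Cons s q)
    then obtain y where s: "s = North y"
      using 1 by (cases s) auto
    obtain r where "q = East # r" "dyck_from 0 r" "successively rise r"
      using decreasing_North_cases[of 0 y q] 1 Cons s by auto
    then show ?thesis
      using 1 Cons s by auto
  qed simp
qed

text \<open>At height 1 the path either takes the additional east step and alternates from the
  diagonal, or makes a north-east pair and is back at height 1.\<close>

lemma decreasing_dyck_from_1:
  assumes "dyck_from (Suc 0) p" "successively rise p" "sorted_wrt (>) (north_labels p)"
  shows "\<exists>j \<le> length (north_labels p). p = extra_east j (north_labels p)"
  using assms
proof (induction p rule: length_induct)
  case (1 p)
  show ?case
  proof (cases p)
    case Nil
    then show ?thesis using 1 by simp
  next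
    case (Cons s q)
    show ?thesis
    proof (cases s)
      case (North y)
      obtain r where r: "q = East # r" "dyck_from (Suc 0) r" "successively rise r"
        using decreasing_North_cases[of "Suc 0" y q] 1 Cons North by auto
      then have "\<exists>j \<le> length (north_labels r). r = extra_east j (north_labels r)"
        using 1 Cons North by (intro "1.IH"[rule_format]) auto
      then obtain j where "j \<le> length (north_labels r)" "r = extra_east j (north_labels r)"
        by blast
      then show ?thesis
        using Cons North r by (intro exI[of _ "Suc j"]) simp
    next
      case East
      then show ?thesis
        using 1 Cons decreasing_dyck_from_0[of q] by (intro exI[of _ 0]) simp
    qed
  qed
qed

section \<open>Decreasing lists of labels\<close>

definition descending :: "nat set \<Rightarrow> nat list" where
  "descending A = rev (sorted_list_of_set A)"

lemma descending_unique:
  assumes "sorted_wrt (>) ys"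
  shows "ys = descending (set ys)"
proof -
  have "sorted_wrt (<) (rev ys)"
    using assms by (simp only: sorted_wrt_rev)
  then have "sorted_list_of_set (set (rev ys)) = rev ys"
    unfolding strict_sorted_iff by (intro sorted_list_of_set.idem_if_sorted_distinct) auto
  then show ?thesis
    by (simp add: descending_def)
qed

lemma sorted_wrt_descending: "sorted_wrt (>) (descending A)"
  by (simp add: descending_def sorted_wrt_rev)

lemma set_descending: "finite A \<Longrightarrow> set (descending A) = A"
  by (simp add: descending_def)

lemma length_descending: "length (descending A) = card A"
  by (simp add: descending_def)

lemma distinct_descending: "distinct (descending A)"
  by (simp add: descending_def)

lemma hd_descending:
  assumes "finite A" "m \<in> A" "\<And>x. x \<in> A \<Longrightarrow> x \<le> m"
  shows "hd (descending A) = m"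
proof (cases "descending A")
  case Nil
  then show ?thesis using assms set_descending[of A] by simp
next
  case (Cons y ys)
  then have "y \<in> A" "m = y \<or> m < y"
    using assms set_descending[of A] sorted_wrt_descending[of A] by auto
  then show ?thesis
    using assms(3)[of y] Cons by auto
qed

section \<open>Parametrization by pairs and the count\<close>

definition path :: "nat \<Rightarrow> nat \<times> nat \<Rightarrow> labelled_step list" where
  "path n = (\<lambda>(a, j). North a # extra_east j (descending ({1..n} - {a})))"

text \<open>Only for \<open>j > 0\<close> does a second north step follow at once; its label is then
  \<open>hd ys\<close>.\<close>

lemma successively_rise_North_extra_east:
  assumes "j \<le> length ys"
  shows "successively rise (North a # extra_east j ys) \<longleftrightarrow> j = 0 \<or> a < hd ys"
  using assms by (cases "(j, ys)" rule: extra_east.cases) (auto simp: successively_Cons)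

text \<open>The largest label other than \<open>a\<close> is \<open>n\<close>, unless
  \<open>a = n\<close>, when it is \<open>n - 1\<close> and thus too small.\<close>

lemma admissible_iff:
  assumes "n \<ge> 1" "a \<in> {1..n}" "j < n"
  shows "j = 0 \<or> a < hd (descending ({1..n} - {a})) \<longleftrightarrow> j = 0 \<or> a < n"
proof (cases "a = n")
  case True
  show ?thesis
  proof (cases "n = 1")
    case False
    then have "hd (descending ({1..n} - {a})) = n - 1"
      using True assms by (intro hd_descending) auto
    then show ?thesis using True by auto
  \<comment> \<open>For \<open>n = 1\<close> no label remains and \<open>hd\<close> is unspecified,
    but \<open>j < n\<close> forces \<open>j = 0\<close>.\<close>
  qed (use assms in simp)
next
  case False
  then have "hd (descending ({1..n} - {a})) = n"
    using assms by (intro hd_descending) auto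
  then show ?thesis by simp
qed

lemma decreasing_tail_parking_functions:
  assumes "n \<ge> 1"
  shows "{p. parking_function n p \<and> sorted_wrt (>) (tl (north_labels p))} =
    path n ` insert (n, 0) ({1..<n} \<times> {..<n})"
  (is "?S = path n ` ?I")
proof (intro equalityI subsetI)
  fix p assume "p \<in> ?S"
  then have p: "dyck_from 0 p" "successively rise p" "set (north_labels p) = {1..n}"
    "distinct (north_labels p)" "sorted_wrt (>) (tl (north_labels p))"
    by (auto simp: parking_function_iff permutations_of_set_def)
  then obtain a q where pq: "p = North a # q"
    \<comment> \<open>An empty path contradicts \<open>n \<ge> 1\<close>, and height 0 forbids an
      initial east step.\<close>
    using assms by (cases "(0::nat, p)" rule: dyck_from.cases) auto
  have a: "a \<in> {1..n}" and set_q: "set (north_labels q) = {1..n} - {a}"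
    using p pq by auto
  have labels: "north_labels q = descending ({1..n} - {a})"
    using descending_unique[of "north_labels q"] p pq set_q by simp
  have "successively rise q"
    using p pq by (auto simp: successively_Cons)
  then obtain j where j: "j \<le> length (north_labels q)" "q = extra_east j (north_labels q)"
    using decreasing_dyck_from_1[of q] p pq by auto
  have "j < n"
    using j(1) a by (auto simp: labels length_descending)
  moreover have "j = 0 \<or> a < hd (descending ({1..n} - {a}))"
    using successively_rise_North_extra_east[of j "north_labels q" a] p(2) pq j labels by metis
  ultimately have "(a, j) \<in> ?I"
    using a admissible_iff[OF assms a] by auto
  moreover have "p = path n (a, j)"
    using pq j labels by (simp add: path_def)
  ultimately show "p \<in> path n ` ?I" by blast
next
  fix p assume "p \<in> path n ` ?I"
  then obtain a j where aj: "(a, j) \<in> ?I" and p: "p = path n (a, j)"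
    by (elim imageE) (metis surj_pair)
  have a: "a \<in> {1..n}" and "j < n" "j = 0 \<or> a < n"
    using aj assms by auto
  moreover have j: "j \<le> length (descending ({1..n} - {a}))"
    using a \<open>j < n\<close> by (simp add: length_descending)
  moreover have "j = 0 \<or> a < hd (descending ({1..n} - {a}))"
    using admissible_iff[OF assms a \<open>j < n\<close>] \<open>j = 0 \<or> a < n\<close> by simp
  ultimately show "p \<in> ?S"
    by (auto simp: p path_def parking_function_iff permutations_of_set_def dyck_from_extra_east
        successively_rise_North_extra_east set_descending distinct_descending
        sorted_wrt_descending)
qed

lemma inj_on_path: "inj_on (path n) (insert (n, 0) ({1..<n} \<times> {..<n}))"
proof (rule inj_onI)
  fix x y
  assume xy: "x \<in> insert (n, 0) ({1..<n} \<times> {..<n})" "y \<in> insert (n, 0) ({1..<n} \<times> {..<n})"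
    and eq: "path n x = path n y"
  obtain a i j where [simp]: "x = (a, i)" "y = (a, j)"
    using eq by (cases x; cases y) (auto simp: path_def)
  \<comment> \<open>Both indices lie in the range on which \<open>extra_east\<close> is
    injective.\<close>
  have "i \<le> card ({1..n} - {a})" "j \<le> card ({1..n} - {a})"
    using xy by auto
  then show "x = y"
    using eq inj_onD[OF inj_on_extra_east[of "descending ({1..n} - {a})"], of i j]
    by (simp add: path_def length_descending)
qed

theorem theorem10:
  fixes n :: nat
  assumes "n \<ge> 1"
  shows "pf n [[1, 2, 3], [2, 1, 3], [3, 1, 2]] = n * (n - 1) + 1"
proof -
  have "pf n [[1, 2, 3], [2, 1, 3], [3, 1, 2]] =
    card {p. parking_function n p \<and> sorted_wrt (>) (tl (north_labels p))}"
    unfolding pf_def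
    by (intro arg_cong[of _ _ card] Collect_cong conj_cong refl avoids_123_213_312_iff)
      (simp add: parking_function_iff permutations_of_set_def)
  also have "\<dots> = card (insert (n, 0) ({1..<n} \<times> {..<n}))"
    by (simp only: decreasing_tail_parking_functions[OF assms] card_image[OF inj_on_path])
  \<comment> \<open>The pair \<open>(n, 0)\<close> lies outside the product, since
    \<open>{1..<n}\<close> omits \<open>n\<close>.\<close>
  also have "\<dots> = n * (n - 1) + 1"
    by simp
  finally show ?thesis .
qed

end
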